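(* Let $K\in[1,\infty)$ and suppose that, for each $i\in\mathbb N$, $f_i:\mathbb R\to\mathbb R$ is $K$-Lipschitz and $g_i:\mathbb R\to\mathbb R$ is $1$-Lipschitz with $f_i(0)=0=g_i(0)$. Let $h_d:\mathbb R^d\to\mathbb R$, $d\in\mathbb N$, be given by $h_1=f_1$ and $h_d(x)=g_d(h_{d-1}(x_1,\dots,x_{d-1})\,f_d(x_d))$ for $d\ge2$. Set $r=\frac{1}{\sqrt8\,K}$. Then for all $d\in\mathbb N$ and $\varepsilon\in(0,\tfrac1{16}]$, there exists $\phi\in\mathcal N$ with $\mathcal R_{\mathrm{ReLU}}^\phi\in C(\mathbb R^d,\mathbb R)$ such that 1) $\sup_{x\in[-r,r]^d}|h_d(x)-\mathcal R_{\mathrm{ReLU}}^\phi(x)|\le\varepsilon$, 2) $\mathcal R_{\mathrm{ReLU}}^\phi$ is $K$-Lipschitz continuous on $\mathbb R^d$, and 3) $\mathcal P(\phi)\le\tfrac37\,10^4\,K^2\,d^{13/2}\,\varepsilon^{-1}$.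
   Context: $\mathbb N=\{1,2,\dots\}$; Lipschitz continuity is with respect to the Euclidean norm. A skeleton is $\phi=[(V_1,b_1),\dots,(V_D,b_D)]$ with $D\in\mathbb N$, $l_0,\dots,l_D\in\mathbb N$, $V_k\in\mathbb R^{l_k\times l_{k-1}}$, $b_k\in\mathbb R^{l_k}$. $\mathcal N$ is the set of all skeletons, and the number of parameters is $\mathcal P(\phi)=\sum_{k=1}^D l_k(l_{k-1}+1)$. With $\mathrm{ReLU}(x)=\max\{x,0\}$ applied componentwise, the ReLU-realization is $\mathcal R_{\mathrm{ReLU}}^\phi=A_D\circ\mathrm{ReLU}\circ A_{D-1}\circ\cdots\circ\mathrm{ReLU}\circ A_1\in C(\mathbb R^{l_0},\mathbb R^{l_D})$ with $A_k(x)=V_kx+b_k$. *)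

theory Defs
  imports "HOL-Analysis.Analysis" "Jordan_Normal_Form.Matrix"
begin

(* Finite-dimensional vectors and matrices are those of Jordan_Normal_Form, because dimensions
   vary within one statement.  Points of R^d are the elements of carrier_vec d, indexed
   from 0, so the i-th coordinate of x is x $ (i - 1).
   The same infix symbols of HOL-Analysis are switched off. *)
unbundle no vec_syntax
unbundle no inner_syntax

definition euclid_norm :: "real vec \<Rightarrow> real" where
  "euclid_norm v = L2_set (\<lambda>i. v $ i) {..<dim_vec v}"

definition lipschitz_vec :: "real \<Rightarrow> nat \<Rightarrow> (real vec \<Rightarrow> real vec) \<Rightarrow> bool" where
  "lipschitz_vec L m F \<longleftrightarrow>
     (\<forall>x\<in>carrier_vec m. \<forall>y\<in>carrier_vec m. euclid_norm (F x - F y) \<le> L * euclid_norm (x - y))"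

definition continuous_maps :: "nat \<Rightarrow> nat \<Rightarrow> (real vec \<Rightarrow> real vec) set" where
  "continuous_maps m n =
     {F \<in> carrier_vec m \<rightarrow> carrier_vec n.
        \<forall>x\<in>carrier_vec m. \<forall>e>0. \<exists>\<delta>>0. \<forall>y\<in>carrier_vec m.
          euclid_norm (y - x) < \<delta> \<longrightarrow> euclid_norm (F y - F x) < e}"

definition cube :: "nat \<Rightarrow> real \<Rightarrow> real vec set" where
  "cube d r = {x \<in> carrier_vec d. \<forall>i<d. x $ i \<in> {-r..r}}"

type_synonym skeleton = "(real mat \<times> real vec) list"

definition skeletons :: "skeleton set" where
  "skeletons = {\<phi>. \<phi> \<noteq> [] \<and>
     (\<exists>l :: nat \<Rightarrow> nat. (\<forall>k\<le>length \<phi>. 1 \<le> l k) \<and>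
        (\<forall>k<length \<phi>. fst (\<phi> ! k) \<in> carrier_mat (l (Suc k)) (l k) \<and>
                       snd (\<phi> ! k) \<in> carrier_vec (l (Suc k))))}"

definition in_dim :: "skeleton \<Rightarrow> nat" where
  "in_dim \<phi> = dim_col (fst (hd \<phi>))"

definition out_dim :: "skeleton \<Rightarrow> nat" where
  "out_dim \<phi> = dim_row (fst (last \<phi>))"

definition num_params :: "skeleton \<Rightarrow> nat" where
  "num_params \<phi> = (\<Sum>(V, b)\<leftarrow>\<phi>. dim_row V * (dim_col V + 1))"

definition ReLU :: "real \<Rightarrow> real" where
  "ReLU x = max x 0"

(* No activation after the last layer; the value for the empty list is irrelevant,
   as it is not a skeleton. *)
fun realization :: "skeleton \<Rightarrow> real vec \<Rightarrow> real vec" where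
  "realization [] x = x"
| "realization [(V, b)] x = V *\<^sub>v x + b"
| "realization ((V, b) # p # \<phi>) x = realization (p # \<phi>) (map_vec ReLU (V *\<^sub>v x + b))"

end

theory Submission
  imports Defs
begin

text \<open>
  Replace each \<open>f\<^sub>i\<close>, each \<open>g\<^sub>i\<close> and the square function by its piecewise linear interpolant
  on an equidistant grid, extended by constants. Interpolation does not increase the Lipschitz
  constant, and the product \<open>a b = ((a + b)\<^sup>2 - (a - b)\<^sup>2) / 4\<close> becomes
  1-Lipschitz for the maximum norm, so that the recursion preserves the Lipschitz constant \<open>K\<close>
  globally. On the cube, \<open>\<bar>f\<^sub>i\<bar> \<le> 3/8\<close>, hence every step of the recursion contracts the earlier
  error by \<open>3/8\<close> and the total error does not depend on \<open>d\<close>. Each of the at most \<open>3 d\<close>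
  interpolations changes one coordinate of a state in \<open>\<real>\<^sup>d\<close> and has one hidden layer. Storing
  the state \<open>s\<close> between them as \<open>ReLU s, ReLU (- s)\<close> keeps the weight matrices thin: one of
  their dimensions is at most \<open>2 d\<close>, so that the number of parameters is linear in the number of
  grid points.
\<close>

section \<open>Piecewise linear interpolation\<close>

lemma ReLU_diff_uminus: "ReLU x - ReLU (- x) = x"
  by (simp add: ReLU_def max_def)

text \<open>The grid on [-A, A] has 2 * n cells of width A / n. The even number makes 0 the knot
  with index n, so the interpolant vanishes at 0 whenever the function does.\<close>

definition knot :: "real \<Rightarrow> nat \<Rightarrow> nat \<Rightarrow> real" where
  "knot A n j = real j * (A / real n) - A"

text \<open>For s \<le> t this is the distance of x from s, clipped to the interval from 0 to t - s:
  a monotone building block that costs two neurons.\<close>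

definition ramp :: "real \<Rightarrow> real \<Rightarrow> real \<Rightarrow> real" where
  "ramp s t x = ReLU (x - s) - ReLU (x - t)"

text \<open>Each cell contributes its slope times its ramp. Since every ramp is constant outside its
  cell, this extends the interpolant by constants, and it is already a ReLU network with one hidden
  layer.\<close>

definition pl :: "(real \<Rightarrow> real) \<Rightarrow> real \<Rightarrow> nat \<Rightarrow> real \<Rightarrow> real" where
  "pl F A n x = F (- A) + (\<Sum>j<2 * n. (F (knot A n (Suc j)) - F (knot A n j)) / (A / real n) *
     ramp (knot A n j) (knot A n (Suc j)) x)"

lemma ramp_mono: "s \<le> t \<Longrightarrow> x \<le> y \<Longrightarrow> ramp s t x \<le> ramp s t y"
  by (auto simp: ramp_def ReLU_def max_def)

lemma sum_ramp:
  "(\<Sum>j<N. ramp (p j) (p (Suc j)) x) = ramp (p 0) (p N) x"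
  by (induction N) (simp_all add: ramp_def)

lemma abs_ramp_diff_le: "s \<le> t \<Longrightarrow> \<bar>ramp s t x - ramp s t y\<bar> \<le> \<bar>x - y\<bar>"
  by (auto simp: ramp_def ReLU_def max_def)

lemma abs_ramp_diff_le_half_width: "\<bar>ramp (- A) A x - ramp (- A) A 0\<bar> \<le> A" if "0 \<le> A"
  using that by (auto simp: ramp_def ReLU_def max_def)

context
  fixes F :: "real \<Rightarrow> real" and A L :: real and n :: nat
  assumes n: "0 < n" and A: "0 < A" and lip: "L-lipschitz_on {- A..A} F"
begin

lemma step_pos: "0 < A / real n"
  using n A by simp

lemma knot_mono: "i \<le> j \<Longrightarrow> knot A n i \<le> knot A n j"
  using step_pos unfolding knot_def by (intro diff_right_mono mult_right_mono) auto

lemma knot_0: "knot A n 0 = - A" and knot_mid: "knot A n n = 0" and knot_end: "knot A n (2 * n) = A"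
  using n by (simp_all add: knot_def)

lemma knot_mem: "j \<le> 2 * n \<Longrightarrow> knot A n j \<in> {- A..A}"
  using knot_mono[of 0 j] knot_mono[of j "2 * n"] by (simp add: knot_0 knot_end)

lemma abs_slope_le:
  assumes "j < 2 * n"
  shows "\<bar>(F (knot A n (Suc j)) - F (knot A n j)) / (A / real n)\<bar> \<le> L"
proof -
  have "dist (F (knot A n (Suc j))) (F (knot A n j)) \<le> L * dist (knot A n (Suc j)) (knot A n j)"
    using assms by (intro lipschitz_onD[OF lip] knot_mem) auto
  moreover have "dist (knot A n (Suc j)) (knot A n j) = A / real n"
    using A by (simp add: dist_real_def knot_def algebra_simps add_divide_distrib)
  ultimately have "\<bar>F (knot A n (Suc j)) - F (knot A n j)\<bar> \<le> L * (A / real n)"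
    by (simp add: dist_real_def)
  then show ?thesis
    using step_pos by (simp only: abs_divide[of _ "A / real n"] abs_of_pos[OF step_pos] pos_divide_le_eq)
qed

text \<open>All cell ramps are increasing and telescope to the ramp of the whole interval, so
  bounding every slope by L costs nothing. Keeping that ramp on the right-hand side yields both the
  global Lipschitz bound and the uniform bound.\<close>

lemma abs_pl_diff_le_ramp: "\<bar>pl F A n x - pl F A n y\<bar> \<le> L * \<bar>ramp (- A) A x - ramp (- A) A y\<bar>"
proof (induction x y rule: linorder_wlog)
  case (le x y)
  let ?R = "\<lambda>j. ramp (knot A n j) (knot A n (Suc j))"
  let ?s = "\<lambda>j. (F (knot A n (Suc j)) - F (knot A n j)) / (A / real n)"
  have mono: "?R j x \<le> ?R j y" for j
    by (intro ramp_mono knot_mono le) auto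
  have "\<bar>pl F A n x - pl F A n y\<bar> = \<bar>\<Sum>j<2 * n. ?s j * (?R j x - ?R j y)\<bar>"
    unfolding pl_def by (simp add: sum_subtractf right_diff_distrib)
  also have "\<dots> \<le> (\<Sum>j<2 * n. L * (?R j y - ?R j x))"
  proof (rule order_trans[OF sum_abs], rule sum_mono)
    fix j assume "j \<in> {..<2 * n}"
    then have "\<bar>?s j\<bar> \<le> L"
      by (intro abs_slope_le) simp
    moreover have "\<bar>?R j x - ?R j y\<bar> = ?R j y - ?R j x"
      using mono[of j] by simp
    ultimately show "\<bar>?s j * (?R j x - ?R j y)\<bar> \<le> L * (?R j y - ?R j x)"
      using mono[of j] by (simp only: abs_mult) (intro mult_right_mono, auto)
  qed
  also have "\<dots> = L * (ramp (- A) A y - ramp (- A) A x)"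
    by (simp only: sum_distrib_left[symmetric] sum_subtractf sum_ramp[of "knot A n"] knot_0 knot_end)
  also have "\<dots> \<le> L * \<bar>ramp (- A) A x - ramp (- A) A y\<bar>"
    by (intro mult_left_mono lipschitz_on_nonneg[OF lip]) auto
  finally show ?case .
qed (simp add: abs_minus_commute)

lemma abs_pl_diff_le: "\<bar>pl F A n x - pl F A n y\<bar> \<le> L * \<bar>x - y\<bar>"
  using A by (intro order_trans[OF abs_pl_diff_le_ramp] mult_left_mono abs_ramp_diff_le
      lipschitz_on_nonneg[OF lip]) auto

text \<open>At a knot each ramp is either complete or still zero, so the sum telescopes.\<close>

lemma pl_knot:
  assumes "k \<le> 2 * n"
  shows "pl F A n (knot A n k) = F (knot A n k)"
proof -
  have ramp: "ramp (knot A n j) (knot A n (Suc j)) (knot A n k) = (if j < k then A / real n else 0)" for j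
  proof (cases "j < k")
    case True
    then show ?thesis
      using knot_mono[of "Suc j" k] knot_mono[of j k]
      by (simp add: ramp_def ReLU_def) (simp add: knot_def algebra_simps add_divide_distrib)
  next
    case False
    then show ?thesis
      using knot_mono[of k j] knot_mono[of k "Suc j"] by (simp add: ramp_def ReLU_def)
  qed
  have "pl F A n (knot A n k) = F (- A) + (\<Sum>j<2 * n. if j < k then F (knot A n (Suc j)) - F (knot A n j) else 0)"
    unfolding pl_def ramp using step_pos by (intro arg_cong2[where f = "(+)"] sum.cong refl) auto
  also have "(\<Sum>j<2 * n. if j < k then F (knot A n (Suc j)) - F (knot A n j) else 0)
      = (\<Sum>j<k. F (knot A n (Suc j)) - F (knot A n j))"
    using assms by (intro sum.mono_neutral_cong_right) auto
  also have "\<dots> = F (knot A n k) - F (knot A n 0)"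
    by (rule sum_lessThan_telescope)
  finally show ?thesis
    by (simp add: knot_0)
qed

text \<open>The value at the middle knot is 0, and the constant extension acts as if x were clipped
  to distance A from it; hence a bound for all real x.\<close>

lemma abs_pl_le:
  assumes "F 0 = 0"
  shows "\<bar>pl F A n x\<bar> \<le> L * A"
proof -
  have "pl F A n 0 = 0"
    using pl_knot[of n] assms by (simp add: knot_mid)
  then have "\<bar>pl F A n x\<bar> \<le> L * \<bar>ramp (- A) A x - ramp (- A) A 0\<bar>"
    using abs_pl_diff_le_ramp[of x 0] by simp
  also have "\<dots> \<le> L * A"
    using A by (intro mult_left_mono abs_ramp_diff_le_half_width lipschitz_on_nonneg[OF lip]) auto
  finally show ?thesis .
qed

text \<open>The interpolant and F agree at a knot at distance at most A / n from x, and both move by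
  at most L times that distance. This is where the factor 2 comes from.\<close>

lemma abs_pl_error_le:
  assumes "x \<in> {- A..A}"
  shows "\<bar>pl F A n x - F x\<bar> \<le> 2 * L * (A / real n)"
proof -
  \<comment> \<open>The index of the last knot that does not exceed x.\<close>
  define k where "k = nat \<lfloor>(x + A) / (A / real n)\<rfloor>"
  have "0 \<le> (x + A) / (A / real n)"
    using assms step_pos by auto
  then have k: "real k \<le> (x + A) / (A / real n)" "(x + A) / (A / real n) < real k + 1"
    unfolding k_def by linarith+
  then have lo: "real k * (A / real n) \<le> x + A" and hi: "x + A < (real k + 1) * (A / real n)"
    using step_pos by (simp_all only: pos_le_divide_eq pos_divide_less_eq)
  have "real k * (A / real n) \<le> real (2 * n) * (A / real n)"
    using lo assms n by simp
  then have k_le: "k \<le> 2 * n"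
    using step_pos by (simp only: mult_le_cancel_right_pos of_nat_le_iff)
  have near: "\<bar>x - knot A n k\<bar> \<le> A / real n"
    using lo hi by (simp add: knot_def algebra_simps add_divide_distrib)
  have L: "0 \<le> L"
    using lip by (rule lipschitz_on_nonneg)
  have "\<bar>pl F A n x - F x\<bar> \<le> \<bar>pl F A n x - pl F A n (knot A n k)\<bar> + \<bar>F x - F (knot A n k)\<bar>"
    unfolding pl_knot[OF k_le] by linarith
  also have "\<bar>F x - F (knot A n k)\<bar> \<le> L * \<bar>x - knot A n k\<bar>"
    using lipschitz_onD[OF lip assms knot_mem[OF k_le]] by (simp add: dist_real_def)
  also have "\<bar>pl F A n x - pl F A n (knot A n k)\<bar> \<le> L * \<bar>x - knot A n k\<bar>"
    by (rule abs_pl_diff_le)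
  also have "L * \<bar>x - knot A n k\<bar> + L * \<bar>x - knot A n k\<bar> \<le> 2 * L * (A / real n)"
    using mult_left_mono[OF near L] by linarith
  finally show ?thesis
    by simp
qed

end

section \<open>Approximate multiplication\<close>

text \<open>The polarization identity with interpolated squares. The subtraction is written with the
  factor - 1/4 so that \<open>shallow_add\<close> and \<open>shallow_cmult\<close> apply
  directly.\<close>

definition pl_mult :: "nat \<Rightarrow> real \<Rightarrow> real \<Rightarrow> real" where
  "pl_mult n a b = 1/4 * pl (\<lambda>t. t\<^sup>2) 1 n (a + b) + (- 1/4) * pl (\<lambda>t. t\<^sup>2) 1 n (a - b)"

lemma lipschitz_on_square: "2-lipschitz_on {- 1..1} (\<lambda>t::real. t\<^sup>2)"
proof (rule lipschitz_onI)
  fix x y :: real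
  assume "x \<in> {- 1..1}" "y \<in> {- 1..1}"
  then have "\<bar>x + y\<bar> * \<bar>x - y\<bar> \<le> 2 * \<bar>x - y\<bar>"
    by (intro mult_right_mono) auto
  then show "dist (x\<^sup>2) (y\<^sup>2) \<le> 2 * dist x y"
    by (simp add: dist_real_def abs_mult[symmetric] power2_eq_square algebra_simps)
qed simp

text \<open>The interpolated square is 2-Lipschitz on all of R. With u = a - a' and v = b - b' the
  change is at most (\<bar>u + v\<bar> + \<bar>u - v\<bar>) / 2, which equals the maximum of
  \<bar>u\<bar> and \<bar>v\<bar>.\<close>

lemma abs_pl_mult_diff_le:
  assumes "0 < n" "\<bar>a - a'\<bar> \<le> \<delta>" "\<bar>b - b'\<bar> \<le> \<delta>"
  shows "\<bar>pl_mult n a b - pl_mult n a' b'\<bar> \<le> \<delta>"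
  using abs_pl_diff_le[OF assms(1) _ lipschitz_on_square, of "a + b" "a' + b'"]
    abs_pl_diff_le[OF assms(1) _ lipschitz_on_square, of "a - b" "a' - b'"] assms
  unfolding pl_mult_def by (auto simp: abs_if split: if_splits)

text \<open>The bounds 1/2 keep a + b and a - b on the grid interval. Each square is then off by at
  most 4 / n, and each enters with weight 1/4.\<close>

lemma abs_pl_mult_error_le:
  assumes "0 < n" "\<bar>a\<bar> \<le> 1/2" "\<bar>b\<bar> \<le> 1/2"
  shows "\<bar>pl_mult n a b - a * b\<bar> \<le> 2 / real n"
proof -
  have mem: "a + b \<in> {- 1..1}" "a - b \<in> {- 1..1}"
    using assms unfolding atLeastAtMost_iff by linarith+
  have "\<bar>pl (\<lambda>t. t\<^sup>2) 1 n (a + b) - (a + b)\<^sup>2\<bar> \<le> 4 / real n"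
    "\<bar>pl (\<lambda>t. t\<^sup>2) 1 n (a - b) - (a - b)\<^sup>2\<bar> \<le> 4 / real n"
    using abs_pl_error_le[OF assms(1) _ lipschitz_on_square, of "a + b"]
      abs_pl_error_le[OF assms(1) _ lipschitz_on_square, of "a - b"] mem by auto
  moreover have "a * b = 1/4 * (a + b)\<^sup>2 - 1/4 * (a - b)\<^sup>2"
    by (simp add: power2_eq_square algebra_simps)
  ultimately show ?thesis
    unfolding pl_mult_def by linarith
qed

section \<open>Networks with one hidden layer\<close>

text \<open>Here m counts the hidden neurons and d the inputs. Weights and states are plain
  functions, so matrices enter only when networks are composed.\<close>

definition shallow :: "nat \<Rightarrow> nat \<Rightarrow> ((nat \<Rightarrow> real) \<Rightarrow> real) \<Rightarrow> bool" where
  "shallow d m \<Phi> \<longleftrightarrow> (\<exists>a U b c. \<forall>s. \<Phi> s = c + (\<Sum>j<m. a j * ReLU ((\<Sum>i<d. U j i * s i) + b j)))"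

lemma shallow_const: "shallow d 0 (\<lambda>s. c)"
  by (auto simp: shallow_def)

lemma shallow_ReLU: "shallow d 1 (\<lambda>s. ReLU ((\<Sum>i<d. u i * s i) + b))"
  unfolding shallow_def
  by (rule exI[of _ "\<lambda>_. 1"], rule exI[of _ "\<lambda>_. u"], rule exI[of _ "\<lambda>_. b"], rule exI[of _ 0]) simp

lemma shallow_cmult:
  assumes "shallow d m \<Phi>"
  shows "shallow d m (\<lambda>s. \<alpha> * \<Phi> s)"
proof -
  obtain a U b c where "\<And>s. \<Phi> s = c + (\<Sum>j<m. a j * ReLU ((\<Sum>i<d. U j i * s i) + b j))"
    using assms unfolding shallow_def by blast
  then show ?thesis
    unfolding shallow_def
    by (intro exI[of _ "\<lambda>j. \<alpha> * a j"] exI[of _ U] exI[of _ b] exI[of _ "\<alpha> * c"])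
      (simp add: distrib_left sum_distrib_left mult.assoc)
qed

lemma sum_lessThan_add:
  fixes f :: "nat \<Rightarrow> 'a :: comm_monoid_add"
  shows "(\<Sum>j<m + k. f j) = (\<Sum>j<m. f j) + (\<Sum>j<k. f (m + j))"
  by (induction k) (simp_all add: add.assoc)

lemma shallow_add:
  assumes "shallow d m \<Phi>" "shallow d k \<Psi>"
  shows "shallow d (m + k) (\<lambda>s. \<Phi> s + \<Psi> s)"
proof -
  obtain a U b c where 1: "\<And>s. \<Phi> s = c + (\<Sum>j<m. a j * ReLU ((\<Sum>i<d. U j i * s i) + b j))"
    using assms unfolding shallow_def by blast
  obtain a' U' b' c' where 2: "\<And>s. \<Psi> s = c' + (\<Sum>j<k. a' j * ReLU ((\<Sum>i<d. U' j i * s i) + b' j))"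
    using assms unfolding shallow_def by blast
  show ?thesis
    unfolding shallow_def
    by (rule exI[of _ "\<lambda>j. if j < m then a j else a' (j - m)"],
        rule exI[of _ "\<lambda>j. if j < m then U j else U' (j - m)"],
        rule exI[of _ "\<lambda>j. if j < m then b j else b' (j - m)"], rule exI[of _ "c + c'"])
      (simp add: 1 2 sum_lessThan_add)
qed

lemma shallow_sum:
  assumes "\<And>j. j < N \<Longrightarrow> shallow d m (\<Phi> j)"
  shows "shallow d (N * m) (\<lambda>s. \<Sum>j<N. \<Phi> j s)"
  using assms
proof (induction N)
  case 0
  then show ?case
    by (simp add: shallow_const)
next
  case (Suc N)
  then have "shallow d (N * m + m) (\<lambda>s. (\<Sum>j<N. \<Phi> j s) + \<Phi> N s)"
    by (intro shallow_add) auto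
  then show ?case
    by (simp add: add.commute)
qed

text \<open>Two neurons for each of the 2 * n ramps.\<close>

lemma shallow_pl: "shallow d (4 * n) (\<lambda>s. pl F A n (\<Sum>i<d. u i * s i))"
proof -
  have "shallow d (1 + 1) (\<lambda>s. ReLU ((\<Sum>i<d. u i * s i) + - p) + - 1 * ReLU ((\<Sum>i<d. u i * s i) + - q))" for p q
    by (intro shallow_add shallow_cmult shallow_ReLU)
  then have ramp: "shallow d 2 (\<lambda>s. ramp p q (\<Sum>i<d. u i * s i))" for p q
    by (simp add: ramp_def numeral_2_eq_2)
  have "shallow d (0 + 2 * n * 2) (\<lambda>s. pl F A n (\<Sum>i<d. u i * s i))"
    unfolding pl_def by (intro shallow_add shallow_const shallow_sum shallow_cmult ramp)
  then show ?thesis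
    by (simp add: mult.commute)
qed

lemma shallow_pl_coord:
  assumes "k < d"
  shows "shallow d (4 * n) (\<lambda>s. pl F A n (s k))"
  using shallow_pl[of d n F A "\<lambda>i. if i = k then 1 else 0"] assms by (simp add: if_distrib[of "\<lambda>x. x * _"] cong: if_cong)

lemma shallow_pl_mult:
  assumes "k < d" "l < d"
  shows "shallow d (8 * n) (\<lambda>s. pl_mult n (s k) (s l))"
proof -
  \<comment> \<open>Combining two indicators gives the right weights also when k = l.\<close>
  have add: "(\<Sum>i<d. ((if i = k then 1 else 0) + (if i = l then 1 else 0)) * s i) = s k + s l"
    and diff: "(\<Sum>i<d. ((if i = k then 1 else 0) - (if i = l then 1 else 0)) * s i) = s k - s l" for s :: "nat \<Rightarrow> real"
    using assms by (simp_all add: distrib_right left_diff_distrib sum.distrib sum_subtractf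
        if_distrib[of "\<lambda>x. x * _"] cong: if_cong)
  have "shallow d (4 * n + 4 * n) (\<lambda>s. pl_mult n (s k) (s l))"
    unfolding pl_mult_def add[symmetric] diff[symmetric] by (intro shallow_add shallow_cmult shallow_pl)
  then show ?thesis
    by simp
qed

section \<open>Composition of networks\<close>

text \<open>The activation follows every layer, including the last. Networks are extended at the end
  of the list, whereas \<open>realization\<close> recurses from its front;
  \<open>realization_snoc\<close> connects the two.\<close>

definition hidden_eval :: "skeleton \<Rightarrow> real vec \<Rightarrow> real vec" where
  "hidden_eval \<phi> x = foldl (\<lambda>x (V, b). map_vec ReLU (V *\<^sub>v x + b)) x \<phi>"

lemma hidden_eval_snoc: "hidden_eval (\<phi> @ [(V, b)]) x = map_vec ReLU (V *\<^sub>v hidden_eval \<phi> x + b)"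
  by (simp add: hidden_eval_def)

lemma realization_snoc: "realization (\<phi> @ [(V, b)]) x = V *\<^sub>v hidden_eval \<phi> x + b"
proof (induction \<phi> arbitrary: x)
  case Nil
  then show ?case
    by (simp add: hidden_eval_def)
next
  case (Cons p \<phi>)
  obtain W c where p: "p = (W, c)"
    by fastforce
  obtain q \<psi> where q: "\<phi> @ [(V, b)] = q # \<psi>"
    by (cases \<phi>) auto
  have "realization ((p # \<phi>) @ [(V, b)]) x = realization (\<phi> @ [(V, b)]) (map_vec ReLU (W *\<^sub>v x + c))"
    by (simp add: p q)
  then show ?case
    by (simp add: Cons.IH p) (simp add: hidden_eval_def)
qed

text \<open>The dimension condition of \<open>skeletons\<close> with the widths l made explicit, so
  that appending a layer is an update of l.\<close>

definition layered :: "(nat \<Rightarrow> nat) \<Rightarrow> skeleton \<Rightarrow> bool" where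
  "layered l \<phi> \<longleftrightarrow> (\<forall>k\<le>length \<phi>. 1 \<le> l k) \<and>
     (\<forall>k<length \<phi>. fst (\<phi> ! k) \<in> carrier_mat (l (Suc k)) (l k) \<and> snd (\<phi> ! k) \<in> carrier_vec (l (Suc k)))"

lemma layered_snoc:
  assumes "layered l \<phi>" "1 \<le> n" "V \<in> carrier_mat n (l (length \<phi>))" "b \<in> carrier_vec n"
  shows "layered (l(Suc (length \<phi>) := n)) (\<phi> @ [(V, b)])"
  using assms by (auto simp: layered_def nth_append less_Suc_eq le_Suc_eq)

lemma num_params_snoc: "num_params (\<phi> @ [(V, b)]) = num_params \<phi> + dim_row V * (dim_col V + 1)"
  by (simp add: num_params_def)

section \<open>Storing a state by its positive and negative parts\<close>

definition split_vec :: "nat \<Rightarrow> (nat \<Rightarrow> real) \<Rightarrow> real vec" where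
  "split_vec d s = vec (d + d) (\<lambda>i. if i < d then ReLU (s i) else ReLU (- s (i - d)))"

text \<open>Applies U to a state given in split form: the second half carries the negated weights
  because s = ReLU s - ReLU (- s).\<close>

definition unsplit_mat :: "nat \<Rightarrow> nat \<Rightarrow> (nat \<Rightarrow> nat \<Rightarrow> real) \<Rightarrow> real mat" where
  "unsplit_mat m d U = mat m (d + d) (\<lambda>(j, i). if i < d then U j i else - U j (i - d))"

lemma mult_mat_vec_index:
  assumes "j < m"
  shows "(mat m n f *\<^sub>v vec n g) $ j = (\<Sum>i<n. f (j, i) * g i)"
  using assms by (simp add: scalar_prod_def lessThan_atLeast0)

lemma unsplit_mat_mult:
  "unsplit_mat m d U *\<^sub>v split_vec d s = vec m (\<lambda>j. \<Sum>i<d. U j i * s i)"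
proof (rule eq_vecI)
  fix j assume "j < dim_vec (vec m (\<lambda>j. \<Sum>i<d. U j i * s i))"
  then have j: "j < m"
    by simp
  have "(unsplit_mat m d U *\<^sub>v split_vec d s) $ j
      = (\<Sum>i<d. U j i * ReLU (s i)) + (\<Sum>i<d. - U j i * ReLU (- s i))"
    unfolding unsplit_mat_def split_vec_def mult_mat_vec_index[OF j] sum_lessThan_add by simp
  also have "\<dots> = (\<Sum>i<d. U j i * (ReLU (s i) - ReLU (- s i)))"
    by (simp add: right_diff_distrib sum_subtractf sum_negf)
  finally show "(unsplit_mat m d U *\<^sub>v split_vec d s) $ j = vec m (\<lambda>j. \<Sum>i<d. U j i * s i) $ j"
    using j by (simp add: ReLU_diff_uminus)
qed (simp add: unsplit_mat_def)

text \<open>\<open>split_net d P F\<close>: some network with \<open>P\<close> parameters maps \<open>x\<close> to the positive and negative parts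
  of the state \<open>F x\<close>, with an activation after its last layer.\<close>

definition split_net :: "nat \<Rightarrow> nat \<Rightarrow> (real vec \<Rightarrow> nat \<Rightarrow> real) \<Rightarrow> bool" where
  "split_net d P F \<longleftrightarrow> (\<exists>\<phi> l. \<phi> \<noteq> [] \<and> layered l \<phi> \<and> l 0 = d \<and> l (length \<phi>) = d + d \<and>
     num_params \<phi> = P \<and> (\<forall>x\<in>carrier_vec d. hidden_eval \<phi> x = split_vec d (F x)))"

lemma split_net_cong:
  assumes "split_net d P F" "\<And>x i. x \<in> carrier_vec d \<Longrightarrow> i < d \<Longrightarrow> F x i = G x i"
  shows "split_net d P G"
proof -
  have "split_vec d (F x) = split_vec d (G x)" if "x \<in> carrier_vec d" for x
    unfolding split_vec_def using assms(2)[OF that] by (intro eq_vecI) auto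
  then show ?thesis
    using assms(1) unfolding split_net_def by auto
qed

lemma split_net_id:
  assumes "1 \<le> d"
  shows "split_net d ((d + d) * (d + 1)) (\<lambda>x i. x $ i)"
proof -
  \<comment> \<open>The identity stacked on its negative; the activation then splits the
    input.\<close>
  define V :: "real mat" where
    "V = mat (d + d) d (\<lambda>(i, j). if i = j then 1 else if i = d + j then - 1 else 0)"
  have V: "V \<in> carrier_mat (d + d) d"
    by (simp add: V_def)
  have "V *\<^sub>v x = vec (d + d) (\<lambda>i. if i < d then x $ i else - x $ (i - d))" if x: "x \<in> carrier_vec d" for x
  proof (rule eq_vecI)
    fix i assume "i < dim_vec (vec (d + d) (\<lambda>i. if i < d then x $ i else - x $ (i - d)))"
    then have i: "i < d + d"
      by simp
    have x_eq: "x = vec d (\<lambda>j. x $ j)"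
      using x by auto
    have "(V *\<^sub>v x) $ i = (\<Sum>j<d. (if i = j then 1 else if i = d + j then - 1 else 0) * x $ j)"
      unfolding V_def by (subst x_eq, subst mult_mat_vec_index[OF i]) simp
    also have "\<dots> = (\<Sum>j<d. if j = (if i < d then i else i - d) then (if i < d then x $ i else - x $ (i - d)) else 0)"
      by (intro sum.cong) auto
    also have "\<dots> = (if i < d then x $ i else - x $ (i - d))"
      using i by (subst sum.delta) auto
    finally show "(V *\<^sub>v x) $ i = vec (d + d) (\<lambda>i. if i < d then x $ i else - x $ (i - d)) $ i"
      using i by simp
  qed (simp add: V_def)
  then have "hidden_eval [(V, 0\<^sub>v (d + d))] x = split_vec d (($) x)" if "x \<in> carrier_vec d" for x
    using that by (auto simp: hidden_eval_def split_vec_def)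
  moreover have "layered (\<lambda>k. if k = 0 then d else d + d) [(V, 0\<^sub>v (d + d))]"
    using assms V by (auto simp: layered_def)
  moreover have "num_params [(V, 0\<^sub>v (d + d))] = (d + d) * (d + 1)"
    using V by (simp add: num_params_def)
  ultimately show ?thesis
    unfolding split_net_def
    by (intro exI[of _ "[(V, 0\<^sub>v (d + d))]"] exI[of _ "\<lambda>k. if k = 0 then d else d + d"]) simp
qed

text \<open>The cost of the two layers appended by \<open>split_net_update\<close>. Both matrices
  have one dimension equal to 2 * d, so the cost is linear in m.\<close>

definition step_params :: "nat \<Rightarrow> nat \<Rightarrow> nat" where
  "step_params d m = (m + (d + d)) * (d + d + 1) + (d + d) * (m + (d + d) + 1)"

text \<open>The first new layer computes the m neurons of \<Phi> next to a fresh copy of the split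
  state. The second forms the updated state, with entry k taken from those neurons, and splits it
  again.\<close>

lemma split_net_update:
  assumes "split_net d P F" "shallow d m \<Phi>" "1 \<le> d"
  shows "split_net d (P + step_params d m) (\<lambda>x. (F x)(k := \<Phi> (F x)))"
proof -
  obtain \<phi> l where \<phi>: "layered l \<phi>" "l 0 = d" "l (length \<phi>) = d + d" "num_params \<phi> = P"
    and eval: "\<And>x. x \<in> carrier_vec d \<Longrightarrow> hidden_eval \<phi> x = split_vec d (F x)"
    using assms(1) unfolding split_net_def by blast
  obtain a U b c where \<Phi>: "\<And>s. \<Phi> s = c + (\<Sum>j<m. a j * ReLU ((\<Sum>i<d. U j i * s i) + b j))"
    using assms(2) unfolding shallow_def by blast
  let ?M = "m + (d + d)"
  \<comment> \<open>Rows below m belong to \<Phi>, the next d rows to s, the last d rows to -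
    s.\<close>
  define V where "V = unsplit_mat ?M d (\<lambda>j i. if j < m then U j i else if j = m + i then 1
      else if j = m + (d + i) then - 1 else 0)"
  define \<beta> where "\<beta> = vec ?M (\<lambda>j. if j < m then b j else 0)"
  \<comment> \<open>Row i expresses entry i of the new state, up to the offset c, by the hidden
    values: entry k from the neurons of \<Phi>, any other entry from its two parts.\<close>
  define w where "w = (\<lambda>i j. if j < m then (if i = k then a j else 0)
      else if i = k then 0 else if j = m + i then 1 else if j = m + (d + i) then - 1 else 0)"
  define W where "W = mat (d + d) ?M (\<lambda>(i, j). if i < d then w i j else - w (i - d) j)"
  \<comment> \<open>The guard \<open>i < d\<close> matters for k \<ge> d: the updated entry is then
    not stored, and index k must not hit the negative half.\<close>
  define \<gamma> where "\<gamma> = vec (d + d) (\<lambda>i. if i = k \<and> i < d then c else if i = d + k then - c else 0)"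
  define hid where "hid = (\<lambda>s j. if j < m then ReLU ((\<Sum>i<d. U j i * s i) + b j)
      else if j < m + d then ReLU (s (j - m)) else ReLU (- s (j - m - d)))"
  have dims: "V \<in> carrier_mat ?M (d + d)" "\<beta> \<in> carrier_vec ?M"
    "W \<in> carrier_mat (d + d) ?M" "\<gamma> \<in> carrier_vec (d + d)"
    by (simp_all add: V_def unsplit_mat_def \<beta>_def W_def \<gamma>_def)
  have hid: "map_vec ReLU (V *\<^sub>v split_vec d s + \<beta>) = vec ?M (hid s)" for s
  proof (rule eq_vecI)
    fix j assume "j < dim_vec (vec ?M (hid s))"
    then have j: "j < ?M"
      by simp
    let ?u = "\<lambda>i. if j < m then U j i else if j = m + i then 1 else if j = m + (d + i) then - 1 else 0"
    have "(\<Sum>i<d. ?u i * s i) = (if j < m then \<Sum>i<d. U j i * s i else if j < m + d then s (j - m) else - s (j - m - d))"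
    proof (cases "j < m")
      case False
      then have "(\<Sum>i<d. ?u i * s i) = (\<Sum>i<d. if i = (if j < m + d then j - m else j - m - d)
          then (if j < m + d then s (j - m) else - s (j - m - d)) else 0)"
        by (intro sum.cong) auto
      also have "\<dots> = (if j < m + d then s (j - m) else - s (j - m - d))"
        using False j by (subst sum.delta) auto
      finally show ?thesis
        using False by simp
    qed simp
    then show "map_vec ReLU (V *\<^sub>v split_vec d s + \<beta>) $ j = vec ?M (hid s) $ j"
      using j by (simp add: V_def unsplit_mat_mult \<beta>_def hid_def)
  qed (simp add: \<beta>_def)
  have w: "(\<Sum>j<?M. w i j * hid s j) + (if i = k then c else 0) = (s(k := \<Phi> s)) i" if i: "i < d" for i s
  proof (cases "i = k")
    case True
    have "(\<Sum>j<?M. w i j * hid s j) = (\<Sum>j<m. a j * ReLU ((\<Sum>i<d. U j i * s i) + b j))"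
      unfolding sum_lessThan_add by (simp add: w_def hid_def True)
    then show ?thesis
      using True by (simp add: \<Phi>)
  next
    case False
    have "(\<Sum>j<m. w i j * hid s j) = 0"
      by (simp add: w_def False)
    moreover have "(\<Sum>j<d. w i (m + j) * hid s (m + j)) = (\<Sum>j<d. if j = i then ReLU (s i) else 0)"
      using False i by (intro sum.cong) (auto simp: w_def hid_def)
    moreover have "(\<Sum>j<d. w i (m + (d + j)) * hid s (m + (d + j))) = (\<Sum>j<d. if j = i then - ReLU (- s i) else 0)"
      using False i by (intro sum.cong) (auto simp: w_def hid_def)
    ultimately have "(\<Sum>j<?M. w i j * hid s j)
        = (\<Sum>j<d. if j = i then ReLU (s i) else 0) + (\<Sum>j<d. if j = i then - ReLU (- s i) else 0)"
      unfolding sum_lessThan_add by simp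
    then show ?thesis
      using False i ReLU_diff_uminus[of "s i"] by simp
  qed
  have out: "map_vec ReLU (W *\<^sub>v vec ?M (hid s) + \<gamma>) = split_vec d (s(k := \<Phi> s))" for s
  proof (rule eq_vecI)
    fix i assume "i < dim_vec (split_vec d (s(k := \<Phi> s)))"
    then have i: "i < d + d"
      by (simp add: split_vec_def)
    then have "map_vec ReLU (W *\<^sub>v vec ?M (hid s) + \<gamma>) $ i
        = ReLU ((\<Sum>j<?M. (if i < d then w i j else - w (i - d) j) * hid s j)
          + (if i = k \<and> i < d then c else if i = d + k then - c else 0))"
      using dims unfolding W_def by (simp add: mult_mat_vec_index[OF i] \<gamma>_def del: mult_mat_vec_def index_mult_mat_vec)
    also have "\<dots> = split_vec d (s(k := \<Phi> s)) $ i"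
    proof (cases "i < d")
      case True
      then show ?thesis
        using w[OF True, of s] by (cases "i = k") (simp_all add: split_vec_def)
    next
      case False
      then have "i - d < d"
        using i by simp
      from w[OF this, of s] show ?thesis
        using False i by (auto simp: split_vec_def sum_negf intro!: arg_cong[where f = ReLU])
    qed
    finally show "map_vec ReLU (W *\<^sub>v vec ?M (hid s) + \<gamma>) $ i = split_vec d (s(k := \<Phi> s)) $ i" .
  qed (simp add: split_vec_def \<gamma>_def)
  define \<phi>' where "\<phi>' = (\<phi> @ [(V, \<beta>)]) @ [(W, \<gamma>)]"
  define l' where "l' = (l(Suc (length \<phi>) := ?M))(Suc (length (\<phi> @ [(V, \<beta>)])) := d + d)"
  have "layered (l(Suc (length \<phi>) := ?M)) (\<phi> @ [(V, \<beta>)])"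
    using \<phi> dims assms(3) by (intro layered_snoc) auto
  then have "layered l' \<phi>'"
    unfolding \<phi>'_def l'_def by (rule layered_snoc) (use dims assms(3) in auto)
  moreover have "hidden_eval \<phi>' x = split_vec d ((F x)(k := \<Phi> (F x)))" if "x \<in> carrier_vec d" for x
    unfolding \<phi>'_def hidden_eval_snoc eval[OF that] hid out ..
  moreover have "num_params \<phi>' = P + step_params d m"
    unfolding \<phi>'_def num_params_snoc \<phi>(4) using dims by (simp add: step_params_def)
  moreover have "\<phi>' \<noteq> []" "l' 0 = d" "l' (length \<phi>') = d + d"
    by (simp_all add: \<phi>'_def l'_def \<phi>(2))
  ultimately show ?thesis
    unfolding split_net_def by blast
qed

text \<open>A last affine layer with one row, and no activation after it, reads off entry k; it
  costs 2 * d + 1 parameters.\<close>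

lemma split_net_coord:
  assumes "split_net d P F" "k < d"
  obtains \<phi> where "\<phi> \<in> skeletons" "in_dim \<phi> = d" "out_dim \<phi> = 1" "num_params \<phi> = P + (d + d + 1)"
    "\<And>x. x \<in> carrier_vec d \<Longrightarrow> realization \<phi> x = vec 1 (\<lambda>_. F x k)"
proof -
  obtain \<phi> l where \<phi>: "\<phi> \<noteq> []" "layered l \<phi>" "l 0 = d" "l (length \<phi>) = d + d" "num_params \<phi> = P"
    and eval: "\<And>x. x \<in> carrier_vec d \<Longrightarrow> hidden_eval \<phi> x = split_vec d (F x)"
    using assms(1) unfolding split_net_def by blast
  define V where "V = unsplit_mat 1 d (\<lambda>_ i. if i = k then 1 else 0)"
  define \<phi>' where "\<phi>' = \<phi> @ [(V, 0\<^sub>v 1)]"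
  have V: "V \<in> carrier_mat 1 (d + d)"
    by (simp add: V_def unsplit_mat_def)
  have "layered (l(Suc (length \<phi>) := 1)) \<phi>'"
    unfolding \<phi>'_def using \<phi> V by (intro layered_snoc) auto
  then have "\<phi>' \<in> skeletons"
    unfolding skeletons_def layered_def by (auto simp: \<phi>'_def)
  moreover have "fst (\<phi> ! 0) \<in> carrier_mat (l (Suc 0)) (l 0)"
    using \<phi>(1,2) unfolding layered_def by blast
  then have "in_dim \<phi>' = d"
    using \<phi>(1,3) by (auto simp: in_dim_def \<phi>'_def hd_conv_nth nth_append)
  moreover have "out_dim \<phi>' = 1"
    using V by (simp add: out_dim_def \<phi>'_def)
  moreover have "num_params \<phi>' = P + (d + d + 1)"
    unfolding \<phi>'_def num_params_snoc \<phi>(5) using V by simp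
  moreover have "realization \<phi>' x = vec 1 (\<lambda>_. F x k)" if "x \<in> carrier_vec d" for x
    unfolding \<phi>'_def realization_snoc eval[OF that] V_def unsplit_mat_mult using assms(2)
    by (auto simp: if_distrib[of "\<lambda>x. x * _"] cong: if_cong)
  ultimately show thesis
    using that by blast
qed

section \<open>The Euclidean norm\<close>

text \<open>Transfers Lipschitz bounds from the maximum norm, for which the network is analyzed, to
  the Euclidean norm with the same constant.\<close>

lemma abs_index_le_euclid_norm: "i < dim_vec v \<Longrightarrow> \<bar>v $ i\<bar> \<le> euclid_norm v"
  using member_le_L2_set[of "{..<dim_vec v}" i "\<lambda>i. \<bar>v $ i\<bar>"]
  by (simp add: euclid_norm_def L2_set_def)

lemma euclid_norm_dim_1: "dim_vec v = 1 \<Longrightarrow> euclid_norm v = \<bar>v $ 0\<bar>"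
  by (simp add: euclid_norm_def L2_set_def lessThan_Suc)

lemma lipschitz_vec_imp_continuous_maps:
  assumes "lipschitz_vec L m F" "F \<in> carrier_vec m \<rightarrow> carrier_vec n" "0 < L"
  shows "F \<in> continuous_maps m n"
proof -
  have "\<exists>\<delta>>0. \<forall>y\<in>carrier_vec m. euclid_norm (y - x) < \<delta> \<longrightarrow> euclid_norm (F y - F x) < e"
    if x: "x \<in> carrier_vec m" and e: "0 < e" for x e
  proof (intro exI[of _ "e / L"] conjI ballI impI)
    fix y assume y: "y \<in> carrier_vec m" "euclid_norm (y - x) < e / L"
    then have "euclid_norm (F y - F x) \<le> L * euclid_norm (y - x)"
      using assms(1) x unfolding lipschitz_vec_def by blast
    also have "\<dots> < e"
      using y(2) assms(3) by (simp add: pos_less_divide_eq mult.commute)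
    finally show "euclid_norm (F y - F x) < e" .
  qed (use assms(3) e in simp)
  then show ?thesis
    using assms(2) unfolding continuous_maps_def by blast
qed

section \<open>The network for the recursion\<close>

text \<open>\<open>h_approx f g r n k\<close> approximates \<open>h\<^sub>k\<^sub>+\<^sub>1\<close>: coordinates are counted from 0, the functions
  \<open>f\<^sub>i\<close> and \<open>g\<^sub>i\<close> from 1.\<close>

fun h_approx :: "(nat \<Rightarrow> real \<Rightarrow> real) \<Rightarrow> (nat \<Rightarrow> real \<Rightarrow> real) \<Rightarrow> real \<Rightarrow> nat \<Rightarrow> nat \<Rightarrow> real vec \<Rightarrow> real" where
  "h_approx f g r n 0 x = pl (f 1) r n (x $ 0)"
| "h_approx f g r n (Suc k) x = pl (g (k + 2)) (1/2) n
     (pl_mult n (h_approx f g r n k x) (pl (f (k + 2)) r n (x $ Suc k)))"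

text \<open>Invariant: entry 0 holds the value of the recursion so far, entries 1 to k hold the
  interpolated factors, later entries still hold the input.\<close>

lemma split_net_h_approx:
  assumes "k < d"
  shows "split_net d ((d + d) * (d + 1) + step_params d (4 * n)
        + k * (2 * step_params d (4 * n) + step_params d (8 * n)))
      (\<lambda>x i. if i = 0 then h_approx f g r n k x else if i \<le> k then pl (f (Suc i)) r n (x $ i) else x $ i)"
    (is "split_net d (?P k) (?F k)")
  using assms
proof (induction k)
  case 0
  have "split_net d (?P 0) (\<lambda>x. (($) x)(0 := pl (f 1) r n (x $ 0)))"
    using split_net_update[OF split_net_id shallow_pl_coord[of 0 d n "f 1" r], of 0] 0 by simp
  then show ?case
    by (rule split_net_cong) auto
next
  case (Suc k)
  \<comment> \<open>One step of the recursion is three updates: interpolate the new factor, multiply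
    it into entry 0, apply the interpolated g there.\<close>
  let ?F1 = "\<lambda>x. (?F k x)(Suc k := pl (f (Suc (Suc k))) r n (?F k x (Suc k)))"
  let ?F2 = "\<lambda>x. (?F1 x)(0 := pl_mult n (?F1 x 0) (?F1 x (Suc k)))"
  let ?F3 = "\<lambda>x. (?F2 x)(0 := pl (g (k + 2)) (1/2) n (?F2 x 0))"
  have "split_net d (?P k) (?F k)" "1 \<le> d"
    using Suc by auto
  then have "split_net d (?P k + step_params d (4 * n)) ?F1"
    using Suc.prems by (intro split_net_update[where \<Phi> = "\<lambda>s. pl (f (Suc (Suc k))) r n (s (Suc k))"] shallow_pl_coord)
  then have "split_net d (?P k + step_params d (4 * n) + step_params d (8 * n)) ?F2"
    using Suc.prems by (intro split_net_update[where \<Phi> = "\<lambda>s. pl_mult n (s 0) (s (Suc k))"] shallow_pl_mult) auto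
  then have "split_net d (?P k + step_params d (4 * n) + step_params d (8 * n) + step_params d (4 * n)) ?F3"
    using Suc.prems by (intro split_net_update[where \<Phi> = "\<lambda>s. pl (g (k + 2)) (1/2) n (s 0)"] shallow_pl_coord) auto
  moreover have "?P k + step_params d (4 * n) + step_params d (8 * n) + step_params d (4 * n) = ?P (Suc k)"
    by (simp add: algebra_simps)
  ultimately have "split_net d (?P (Suc k)) ?F3"
    by (simp only:)
  then show ?case
    by (rule split_net_cong) (auto simp: le_Suc_eq)
qed

text \<open>With q = n * d^2, a recursion step costs at most (2 * 32 + 52) * q = 116 * q. Start and
  final layer together cost at most (32 + 7) * q and count as one more step, so at most d steps are
  paid for.\<close>

lemma params_bound:
  fixes d n k :: nat
  assumes "k < d" "1 \<le> n"
  shows "(d + d) * (d + 1) + step_params d (4 * n)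
        + k * (2 * step_params d (4 * n) + step_params d (8 * n)) + (d + d + 1) \<le> 116 * n * d ^ 3"
proof -
  define q where "q = n * (d * d)"
  have "1 \<le> d * d" "1 \<le> d" "d \<le> d * d"
    using assms by auto
  then have "n * 1 \<le> q" "1 * (d * d) \<le> q" "n * d \<le> q" "1 * d \<le> q" "1 * 1 \<le> q"
    unfolding q_def using assms(2) by (intro mult_le_mono; simp)+
  moreover have "step_params d m = 4 * (m * d) + m + 8 * (d * d) + 4 * d" for m
    by (simp add: step_params_def algebra_simps)
  ultimately have step: "step_params d (4 * n) \<le> 32 * q" "step_params d (8 * n) \<le> 52 * q"
    and rest: "(d + d) * (d + 1) + (d + d + 1) \<le> 7 * q"
    by (simp_all add: algebra_simps)
  have "k * (2 * step_params d (4 * n) + step_params d (8 * n)) \<le> k * (116 * q)"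
    using step by (intro mult_le_mono2) linarith
  moreover have "k * (116 * q) + 116 * q \<le> d * (116 * q)"
    using assms(1) mult_le_mono1[of "Suc k" d "116 * q"] by simp
  moreover have "d * (116 * q) = 116 * n * d ^ 3"
    by (simp add: q_def power3_eq_cube)
  ultimately show ?thesis
    using step(1) rest by linarith
qed

section \<open>Stability and accuracy of the recursion\<close>

context
  fixes K r :: real and f g :: "nat \<Rightarrow> real \<Rightarrow> real" and n :: nat
  assumes K: "1 \<le> K"
    and f_lip: "\<And>i. 1 \<le> i \<Longrightarrow> K-lipschitz_on UNIV (f i)"
    and g_lip: "\<And>i. 1 \<le> i \<Longrightarrow> 1-lipschitz_on UNIV (g i)"
    and f_0: "\<And>i. 1 \<le> i \<Longrightarrow> f i 0 = 0"
    and g_0: "\<And>i. 1 \<le> i \<Longrightarrow> g i 0 = 0"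
    and r: "0 < r" "K * r \<le> 3/8"
    and n: "0 < n"
begin

lemma f_lip_interval: "1 \<le> i \<Longrightarrow> K-lipschitz_on {- r..r} (f i)"
  by (rule lipschitz_on_subset[OF f_lip]) auto

lemma g_lip_interval: "1 \<le> i \<Longrightarrow> 1-lipschitz_on {- (1/2)..1/2} (g i)"
  by (rule lipschitz_on_subset[OF g_lip]) auto

text \<open>The factor K enters only through the interpolated f. The approximate product keeps a
  bound common to both arguments, and the interpolated g is 1-Lipschitz, so nothing accumulates over
  the steps.\<close>

lemma abs_h_approx_diff_le:
  assumes "\<And>i. i \<le> k \<Longrightarrow> \<bar>x $ i - y $ i\<bar> \<le> \<delta>"
  shows "\<bar>h_approx f g r n k x - h_approx f g r n k y\<bar> \<le> K * \<delta>"
proof -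
  have f: "\<bar>pl (f (Suc i)) r n (x $ i) - pl (f (Suc i)) r n (y $ i)\<bar> \<le> K * \<delta>" if "i \<le> k" for i
  proof -
    have "\<bar>pl (f (Suc i)) r n (x $ i) - pl (f (Suc i)) r n (y $ i)\<bar> \<le> K * \<bar>x $ i - y $ i\<bar>"
      by (intro abs_pl_diff_le n r f_lip_interval) simp
    also have "\<dots> \<le> K * \<delta>"
      using assms[OF that] K by (intro mult_left_mono) auto
    finally show ?thesis .
  qed
  have "\<bar>h_approx f g r n j x - h_approx f g r n j y\<bar> \<le> K * \<delta>" if "j \<le> k" for j
    using that
  proof (induction j)
    case 0
    then show ?case
      using f[of 0] by simp
  next
    case (Suc j)
    let ?p = "\<lambda>x. pl_mult n (h_approx f g r n j x) (pl (f (j + 2)) r n (x $ Suc j))"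
    have "\<bar>h_approx f g r n (Suc j) x - h_approx f g r n (Suc j) y\<bar> \<le> 1 * \<bar>?p x - ?p y\<bar>"
      unfolding h_approx.simps by (intro abs_pl_diff_le n g_lip_interval) auto
    also have "\<dots> = \<bar>?p x - ?p y\<bar>"
      by (rule mult_1)
    also have "\<dots> \<le> K * \<delta>"
      using Suc f[of "Suc j"] by (intro abs_pl_mult_diff_le n) auto
    finally show ?case .
  qed
  then show ?thesis
    by simp
qed

text \<open>The constant extension of the outermost interpolant gives the bound for every x; it is
  what \<open>abs_pl_mult_error_le\<close> asks of the first argument.\<close>

lemma abs_h_approx_le: "\<bar>h_approx f g r n k x\<bar> \<le> 1/2"
proof (cases k)
  case 0
  have "\<bar>h_approx f g r n k x\<bar> \<le> K * r"
    unfolding 0 h_approx.simps by (intro abs_pl_le n r f_lip_interval f_0) auto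
  then show ?thesis
    using r by linarith
next
  case (Suc j)
  have "\<bar>h_approx f g r n k x\<bar> \<le> 1 * (1/2)"
    unfolding Suc h_approx.simps by (intro abs_pl_le n g_lip_interval g_0) auto
  then show ?thesis
    by simp
qed

text \<open>Size and error are proved together, since the size bound on h makes the next error step
  work. The error bound 6 / n reproduces itself because the earlier error is multiplied by a factor
  of at most 3/8.\<close>

lemma h_approx_error:
  fixes h :: "nat \<Rightarrow> real vec \<Rightarrow> real"
  assumes h_1: "\<And>x. x \<in> carrier_vec 1 \<Longrightarrow> h 1 x = f 1 (x $ 0)"
    and h_Suc: "\<And>d x. 2 \<le> d \<Longrightarrow> x \<in> carrier_vec d \<Longrightarrow>
           h d x = g d (h (d - 1) (vec_first x (d - 1)) * f d (x $ (d - 1)))"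
    and x: "\<And>i. i \<le> k \<Longrightarrow> x $ i \<in> {- r..r}"
  shows "\<bar>h (Suc k) (vec_first x (Suc k))\<bar> \<le> 3/8 \<and>
    \<bar>h_approx f g r n k x - h (Suc k) (vec_first x (Suc k))\<bar> \<le> 6 / real n"
proof -
  have f_le: "\<bar>f (Suc i) (x $ i)\<bar> \<le> 3/8" if "i \<le> k" for i
  proof -
    have "\<bar>f (Suc i) (x $ i)\<bar> \<le> K * \<bar>x $ i\<bar>"
      using lipschitz_onD[OF f_lip, of "Suc i" "x $ i" 0] f_0[of "Suc i"] by (simp add: dist_real_def)
    also have "\<dots> \<le> K * r"
      using x[OF that] K by (intro mult_left_mono) auto
    finally show ?thesis
      using r by linarith
  qed
  have f_err: "\<bar>pl (f (Suc i)) r n (x $ i) - f (Suc i) (x $ i)\<bar> \<le> 3/4 / real n" if "i \<le> k" for i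
  proof -
    have "\<bar>pl (f (Suc i)) r n (x $ i) - f (Suc i) (x $ i)\<bar> \<le> 2 * K * (r / real n)"
      using x[OF that] by (intro abs_pl_error_le n r f_lip_interval) auto
    also have "\<dots> = 2 * (K * r) / real n"
      by simp
    also have "\<dots> \<le> 3/4 / real n"
      using r by (intro divide_right_mono) auto
    finally show ?thesis .
  qed
  show ?thesis
    using x f_le f_err
  proof (induction k)
    case 0
    then have "h (Suc 0) (vec_first x (Suc 0)) = f 1 (x $ 0)"
      using h_1[of "vec_first x 1"] by (simp add: vec_first_def)
    moreover have "3/4 / real n \<le> 6 / real n"
      by (intro divide_right_mono) auto
    ultimately show ?case
      using "0.prems"(2,3)[of 0] by (auto intro: order_trans)
  next
    case (Suc k)
    define H where "H = h (Suc k) (vec_first x (Suc k))"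
    define H' where "H' = h_approx f g r n k x"
    define F where "F = f (k + 2) (x $ Suc k)"
    define F' where "F' = pl (f (k + 2)) r n (x $ Suc k)"
    have "vec_first (vec_first x (Suc (Suc k))) (Suc k) = vec_first x (Suc k)"
      by (auto simp: vec_first_def)
    then have h_eq: "h (Suc (Suc k)) (vec_first x (Suc (Suc k))) = g (k + 2) (H * F)"
      using h_Suc[of "Suc (Suc k)" "vec_first x (Suc (Suc k))"] by (simp add: H_def F_def vec_first_def)
    have IH: "\<bar>H\<bar> \<le> 3/8" "\<bar>H' - H\<bar> \<le> 6 / real n"
      using Suc unfolding H_def H'_def by auto
    have F: "\<bar>F\<bar> \<le> 3/8" "\<bar>F' - F\<bar> \<le> 3/4 / real n"
      using Suc.prems(2,3)[of "Suc k"] unfolding F_def F'_def by auto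
    have F': "\<bar>F'\<bar> \<le> K * r"
      unfolding F'_def by (intro abs_pl_le n r f_lip_interval f_0) auto
    have HF: "\<bar>H * F\<bar> \<le> 3/8 * (3/8)"
      unfolding abs_mult using IH F by (intro mult_mono) auto
    have "\<bar>g (k + 2) (H * F)\<bar> \<le> 1 * \<bar>H * F\<bar>"
      using lipschitz_onD[OF g_lip, of "k + 2" "H * F" 0] g_0[of "k + 2"] by (simp add: dist_real_def)
    with HF have bound: "\<bar>g (k + 2) (H * F)\<bar> \<le> 3/8"
      by simp
    have "\<bar>F' * (H' - H)\<bar> \<le> 3/8 * (6 / real n)"
      unfolding abs_mult using F' r IH by (intro mult_mono) auto
    moreover have "\<bar>H * (F' - F)\<bar> \<le> 3/8 * (3/4 / real n)"
      unfolding abs_mult using IH F by (intro mult_mono) auto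
    \<comment> \<open>This splitting puts the contracting factor F', bounded by K * r, in front of
      the earlier error.\<close>
    moreover have "H' * F' - H * F = F' * (H' - H) + H * (F' - F)"
      by (simp add: algebra_simps)
    ultimately have prod: "\<bar>H' * F' - H * F\<bar> \<le> 3/8 * (6 / real n) + 3/8 * (3/4 / real n)"
      using abs_triangle_ineq[of "F' * (H' - H)" "H * (F' - F)"] by simp
    have mult: "\<bar>pl_mult n H' F' - H' * F'\<bar> \<le> 2 / real n"
      using F' r abs_h_approx_le[of k x] by (intro abs_pl_mult_error_le n) (auto simp: H'_def)
    let ?G = "pl (g (k + 2)) (1/2) n"
    \<comment> \<open>The interpolant of g is compared with g at the exact product, which is known
      to lie in [-1/2, 1/2].\<close>
    have "\<bar>?G (pl_mult n H' F') - g (k + 2) (H * F)\<bar>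
        \<le> \<bar>?G (pl_mult n H' F') - ?G (H * F)\<bar> + \<bar>?G (H * F) - g (k + 2) (H * F)\<bar>"
      by linarith
    also have "\<bar>?G (pl_mult n H' F') - ?G (H * F)\<bar> \<le> 1 * \<bar>pl_mult n H' F' - H * F\<bar>"
      by (intro abs_pl_diff_le n g_lip_interval) auto
    also have "\<bar>pl_mult n H' F' - H * F\<bar> \<le> \<bar>pl_mult n H' F' - H' * F'\<bar> + \<bar>H' * F' - H * F\<bar>"
      by linarith
    also note mult
    also note prod
    also have "\<bar>?G (H * F) - g (k + 2) (H * F)\<bar> \<le> 2 * 1 * (1/2 / real n)"
      using HF by (intro abs_pl_error_le n g_lip_interval) auto
    \<comment> \<open>In units of 1 / n: product 2, earlier error 2.25, error of the new factor
      0.28125, interpolation of g 1. The total 5.53125 stays below 6.\<close>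
    also have "1 * (2 / real n + (3/8 * (6 / real n) + 3/8 * (3/4 / real n))) + 2 * 1 * (1/2 / real n) \<le> 6 / real n"
      using n by (simp add: field_simps)
    finally have "\<bar>?G (pl_mult n H' F') - g (k + 2) (H * F)\<bar> \<le> 6 / real n"
      by simp
    then show ?case
      using bound unfolding h_eq by (simp add: H'_def F'_def)
  qed
qed

end

section \<open>The approximation theorem\<close>

theorem proposition32:
  fixes K r :: real
    and f g :: "nat \<Rightarrow> real \<Rightarrow> real"
    and h :: "nat \<Rightarrow> real vec \<Rightarrow> real"
  assumes "1 \<le> K"
    and "\<And>i. 1 \<le> i \<Longrightarrow> lipschitz_on K UNIV (f i)"
    and "\<And>i. 1 \<le> i \<Longrightarrow> lipschitz_on 1 UNIV (g i)"
    and "\<And>i. 1 \<le> i \<Longrightarrow> f i 0 = 0"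
    and "\<And>i. 1 \<le> i \<Longrightarrow> g i 0 = 0"
    and "\<And>x. x \<in> carrier_vec 1 \<Longrightarrow> h 1 x = f 1 (x $ 0)"
    and "\<And>d x. 2 \<le> d \<Longrightarrow> x \<in> carrier_vec d \<Longrightarrow>
           h d x = g d (h (d - 1) (vec_first x (d - 1)) * f d (x $ (d - 1)))"
    and "r = 1 / (sqrt 8 * K)"
  shows "\<forall>d::nat. \<forall>\<epsilon>::real. 1 \<le> d \<longrightarrow> \<epsilon> \<in> {0<..1/16} \<longrightarrow>
    (\<exists>\<phi>\<in>skeletons. in_dim \<phi> = d \<and> out_dim \<phi> = 1 \<and> realization \<phi> \<in> continuous_maps d 1 \<and>
       (SUP x\<in>cube d r. ereal \<bar>h d x - realization \<phi> x $ 0\<bar>) \<le> ereal \<epsilon> \<and>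
       lipschitz_vec K d (realization \<phi>) \<and>
       real (num_params \<phi>) \<le> 3 / 7 * 10 ^ 4 * K ^ 2 * real d powr (13 / 2) * inverse \<epsilon>)"
proof (intro allI impI)
  fix d :: nat and \<epsilon> :: real
  assume d: "1 \<le> d" and "\<epsilon> \<in> {0<..1/16}"
  then have \<epsilon>: "0 < \<epsilon>" "\<epsilon> \<le> 1/16"
    by auto
  \<comment> \<open>Gives a rational bound 3/8 for K * r = 1 / sqrt 8.\<close>
  have "8/3 \<le> sqrt 8"
    by (rule real_le_rsqrt) (simp add: power2_eq_square)
  then have r: "0 < r" "K * r \<le> 3/8"
    using assms(1) unfolding assms(8) by (auto simp: field_simps)
  \<comment> \<open>The smallest n with 6 / n \<le> \<epsilon>; rounding up keeps n \<le> 7 /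
    \<epsilon> since \<epsilon> \<le> 1.\<close>
  define n where "n = nat \<lceil>6 / \<epsilon>\<rceil>"
  have n: "6 / \<epsilon> \<le> real n" "real n \<le> 6 / \<epsilon> + 1"
    using \<epsilon> zero_le_ceiling[of "6 / \<epsilon>"] ceiling_correct[of "6 / \<epsilon>"] unfolding n_def by simp_all
  then have n_pos: "0 < n"
    using \<epsilon> by (cases n) auto
  obtain k where k: "d = Suc k"
    using d by (cases d) auto
  let ?P = "(d + d) * (d + 1) + step_params d (4 * n) + k * (2 * step_params d (4 * n) + step_params d (8 * n))"
  obtain \<phi> where \<phi>: "\<phi> \<in> skeletons" "in_dim \<phi> = d" "out_dim \<phi> = 1" "num_params \<phi> = ?P + (d + d + 1)"
    and real: "\<And>x. x \<in> carrier_vec d \<Longrightarrow> realization \<phi> x = vec 1 (\<lambda>_. h_approx f g r n k x)"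
    using split_net_coord[OF split_net_h_approx[of k d n f g r], of 0] k by auto
  have lip: "lipschitz_vec K d (realization \<phi>)"
    unfolding lipschitz_vec_def
  proof (intro ballI)
    fix x y :: "real vec"
    assume x: "x \<in> carrier_vec d" and y: "y \<in> carrier_vec d"
    have "\<bar>x $ i - y $ i\<bar> \<le> euclid_norm (x - y)" if "i \<le> k" for i
      using abs_index_le_euclid_norm[of i "x - y"] x y that k by simp
    then have "\<bar>h_approx f g r n k x - h_approx f g r n k y\<bar> \<le> K * euclid_norm (x - y)"
      by (intro abs_h_approx_diff_le[where K = K] assms r n_pos)
    then show "euclid_norm (realization \<phi> x - realization \<phi> y) \<le> K * euclid_norm (x - y)"
      by (simp add: real x y euclid_norm_dim_1)
  qed
  then have cont: "realization \<phi> \<in> continuous_maps d 1"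
    using assms(1) by (intro lipschitz_vec_imp_continuous_maps) (auto simp: real)
  have "(SUP x\<in>cube d r. ereal \<bar>h d x - realization \<phi> x $ 0\<bar>) \<le> ereal \<epsilon>"
  proof (rule SUP_least)
    fix x assume "x \<in> cube d r"
    then have x: "x \<in> carrier_vec d" "\<And>i. i \<le> k \<Longrightarrow> x $ i \<in> {- r..r}"
      unfolding cube_def k by auto
    have "vec_first x (Suc k) = x"
      using x(1) k by (auto simp: vec_first_def)
    moreover have "\<bar>h_approx f g r n k x - h (Suc k) (vec_first x (Suc k))\<bar> \<le> 6 / real n"
      by (intro h_approx_error[where K = K, THEN conjunct2] assms r n_pos x)
    ultimately have "\<bar>h_approx f g r n k x - h d x\<bar> \<le> 6 / real n"
      using k by simp
    also have "\<dots> \<le> \<epsilon>"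
      using n(1) n_pos \<epsilon> by (simp add: field_simps)
    finally show "ereal \<bar>h d x - realization \<phi> x $ 0\<bar> \<le> ereal \<epsilon>"
      by (simp add: real x(1) abs_minus_commute)
  qed
  moreover have "real (num_params \<phi>) \<le> 3 / 7 * 10 ^ 4 * K ^ 2 * real d powr (13 / 2) * inverse \<epsilon>"
  proof -
    have "real (num_params \<phi>) \<le> real (116 * n * d ^ 3)"
      unfolding \<phi>(4) of_nat_le_iff using k n_pos by (intro params_bound) auto
    also have "\<dots> = 116 * (real n * real d powr 3)"
      using d by (simp add: powr_numeral)
    also have "\<dots> \<le> 116 * ((7 * inverse \<epsilon>) * real d powr (13/2))"
    proof -
      have "real n \<le> 7 * inverse \<epsilon>"
        using n(2) \<epsilon> by (simp add: field_simps)
      moreover have "real d powr 3 \<le> real d powr (13/2)"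
        using d by (intro powr_mono) auto
      ultimately show ?thesis
        using \<epsilon> by (intro mult_left_mono mult_mono) auto
    qed
    \<comment> \<open>Here 812 = 116 * 7 is below 30000 / 7, and the factor 1 is there to be
      compared with K^2.\<close>
    also have "\<dots> = 812 * 1 * (real d powr (13/2) * inverse \<epsilon>)"
      by simp
    also have "\<dots> \<le> (3 / 7 * 10 ^ 4) * K ^ 2 * (real d powr (13/2) * inverse \<epsilon>)"
      using \<epsilon> assms(1) by (intro mult_right_mono mult_mono) auto
    finally show ?thesis
      by (simp add: mult.assoc)
  qed
  ultimately show "\<exists>\<phi>\<in>skeletons. in_dim \<phi> = d \<and> out_dim \<phi> = 1 \<and> realization \<phi> \<in> continuous_maps d 1 \<and>
       (SUP x\<in>cube d r. ereal \<bar>h d x - realization \<phi> x $ 0\<bar>) \<le> ereal \<epsilon> \<and>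
       lipschitz_vec K d (realization \<phi>) \<and>
       real (num_params \<phi>) \<le> 3 / 7 * 10 ^ 4 * K ^ 2 * real d powr (13 / 2) * inverse \<epsilon>"
    using \<phi>(1-3) cont lip by blast
qed

end
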